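(* Let $a\ge a_1=\frac{40+3\sqrt{205}}{105}$. Then for all $n\in\mathbb{N}$ we have $$\mathcal{L}(n,a)+c_1(a)<H_n<\mathcal{L}(n,a)+\gamma,$$ where $c_1(a)=1-\mathcal{L}(1,a)$ and $\gamma$ are the best possible. Moreover, the lower bound $\mathcal{L}(n,a)+c_1(a)$ and the upper bound $\mathcal{L}(n,a)+\gamma$ are respectively decreasing and increasing in $a$ on $(a_1,\infty)$.
   Context: $\mathbb{N}=\{1,2,3,\ldots\}$, $H_n=\sum_{k=1}^n\frac1k$ is the $n$-th harmonic number, and $\gamma=0.5772\ldots$ is the Euler–Mascheroni constant. For $x>0$ and $a>1/15$, $$\mathcal{L}(x,a)=\frac{1}{90a^{2}+2}\ln\left(x^{2}+x+\frac{3a+1}{3}\right)+\frac{45a^{2}}{90a^{2}+2}\ln\left(x^{2}+x+\frac{15a-1}{45a}\right).$$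
   Formalization: At n=1 the lower bound equals H_1=1 for every a, so the strict lower inequality fails there; it is proved as ≤ for all n with equality exactly at n=1, and the lower bound is strictly decreasing in a for n≥2, constant for n=1. *)

theory Defs
  imports "HOL-Analysis.Analysis"
begin

text \<open>The intended domain is \<open>x > 0\<close> and \<open>a > 1/15\<close>, where both logarithms have positive arguments.\<close>

definition L_approx :: "real \<Rightarrow> real \<Rightarrow> real" where
  "L_approx x a =
     1 / (90 * a\<^sup>2 + 2) * ln (x\<^sup>2 + x + (3 * a + 1) / 3)
   + 45 * a\<^sup>2 / (90 * a\<^sup>2 + 2) * ln (x\<^sup>2 + x + (15 * a - 1) / (45 * a))"

definition a1 :: real where
  "a1 = (40 + 3 * sqrt 205) / 105"

definition c1 :: "real \<Rightarrow> real" where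
  "c1 a = 1 - L_approx 1 a"

text \<open>
  \<open>L_approx n a + c1 a\<close> is a lower bound for \<open>harm n\<close> that is attained exactly at \<open>n = 1\<close>:
  by the choice of \<open>c1\<close>, at \<open>n = 1\<close> the bound equals \<open>1 = harm 1\<close> for every \<open>a\<close>.  Strict
  inequality and strict monotonicity of the lower bound are therefore claims about \<open>n \<ge> 2\<close>.
\<close>

end

theory Submission
  imports Defs "HOL-Real_Asymp.Real_Asymp"
begin

text \<open>
  Write \<open>p = 1/3 + a\<close>, \<open>q = 1/3 - 1/(45 a)\<close> and \<open>w = 1/(45 a\<^sup>2 + 1)\<close>.  Then \<open>L_approx x a\<close> is half
  of the weighted average of \<open>ln (x\<^sup>2 + x + p)\<close> and \<open>ln (x\<^sup>2 + x + q)\<close> with weights \<open>w\<close> and \<open>1 - w\<close>.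
  The parametrisation by \<open>a\<close> is the general solution of the two moment equations
  \<open>w p + (1 - w) q = 1/3\<close> and \<open>w p\<^sup>2 + (1 - w) q\<^sup>2 = 2/15\<close> with \<open>p > q\<close>, which are what is needed to
  match the terms \<open>1/(6 t) - 1/(30 t\<^sup>2)\<close>, where \<open>t = n\<^sup>2 + n\<close>, in the asymptotic expansion of the
  harmonic numbers.  The next term is matched exactly when \<open>p + q = 10/7\<close>, and for positive \<open>a\<close> the
  inequality \<open>p + q \<ge> 10/7\<close> says precisely that \<open>a \<ge> a1\<close> (\<open>node_sum_ge\<close>).

  All the bounds follow from one fact: the error \<open>harm n - L_approx n a\<close> increases strictly with \<open>n\<close>
  and tends to \<open>euler_mascheroni\<close>.  It therefore stays below \<open>euler_mascheroni\<close>, which cannot be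
  improved because it is the limit, and it is least at \<open>n = 1\<close>, where its value is \<open>c1 a\<close>.  Strict
  increase means \<open>L_approx y a - L_approx (y - 1) a < 1 / y\<close> (\<open>L_approx_increment_less\<close>).  Both sides
  vanish at infinity, so it suffices that \<open>1 / y\<close> minus the increment has a negative derivative.  This
  derivative is a rational function of \<open>z = y\<^sup>2\<close>.  The moment equations cancel all but the two lowest
  coefficients of its numerator, which is \<open>(p q)\<^sup>2 + (7 (p + q) - 10)/45 * z\<close> up to sign
  (\<open>increment_rational_identity\<close>), and this is positive when \<open>a \<ge> a1\<close>.

  For the dependence on \<open>a\<close>, the derivative of \<open>L_approx x a\<close> in \<open>a\<close> is a positive factor times the
  amount by which the trapezoidal rule overestimates the mean of \<open>1 / s\<close> over the interval from
  \<open>x\<^sup>2 + x + q\<close> to \<open>x\<^sup>2 + x + p\<close> (\<open>L_approx_deriv_parameter\<close>).  This excess is positive, so the upper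
  bound increases with \<open>a\<close>.  It also shrinks when the interval moves to the right, so
  \<open>L_approx n a - L_approx 1 a\<close>, and with it the lower bound, decreases with \<open>a\<close> for \<open>n \<ge> 2\<close>.
\<close>

section \<open>A two-point average of logarithms\<close>

definition node_p :: "real \<Rightarrow> real" where
  "node_p a = 1 / 3 + a"

definition node_q :: "real \<Rightarrow> real" where
  "node_q a = 1 / 3 - 1 / (45 * a)"

definition weight :: "real \<Rightarrow> real" where
  "weight a = 1 / (45 * a\<^sup>2 + 1)"

lemma L_approx_weighted:
  assumes "a > 0"
  shows "L_approx x a =
    (weight a * ln (x\<^sup>2 + x + node_p a) + (1 - weight a) * ln (x\<^sup>2 + x + node_q a)) / 2"
proof -
  have pos: "45 * a\<^sup>2 + 1 > 0"
    by (simp add: add_nonneg_pos)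
  have p: "(3 * a + 1) / 3 = node_p a" and q: "(15 * a - 1) / (45 * a) = node_q a"
    using assms by (simp_all add: node_p_def node_q_def field_simps)
  have w: "1 / (90 * a\<^sup>2 + 2) = weight a / 2" "45 * a\<^sup>2 / (90 * a\<^sup>2 + 2) = (1 - weight a) / 2"
    using pos by (simp_all add: weight_def field_simps)
  show ?thesis
    unfolding L_approx_def p q w by (simp add: field_simps)
qed

lemma node_p_pos: "a > 0 \<Longrightarrow> node_p a > 0"
  by (simp add: node_p_def)

lemma node_q_pos: "a > 1 / 15 \<Longrightarrow> node_q a > 0"
  by (simp add: node_q_def field_simps)

lemma weight_pos: "weight a > 0"
  by (simp add: weight_def add_nonneg_pos)

lemma node_mean:
  assumes "a > 0"
  shows "weight a * node_p a + (1 - weight a) * node_q a = 1 / 3"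
proof -
  have "45 * a\<^sup>2 + 1 > 0"
    by (simp add: add_nonneg_pos)
  then have "weight a * (45 * a\<^sup>2 + 1) = 1"
    by (simp add: weight_def)
  moreover have "1 / (45 * a) * (45 * a) = 1"
    using assms by simp
  ultimately have "(weight a * node_p a + (1 - weight a) * node_q a - 1 / 3) * (45 * a) = 0"
    unfolding node_p_def node_q_def by algebra
  then show ?thesis using assms by simp
qed

text \<open>
  The two nodes satisfy \<open>(p - 1/3) (q - 1/3) = - 1/45\<close>; given the mean \<open>1/3\<close>, this is the same as
  prescribing the second moment \<open>2/15\<close>, since \<open>w p\<^sup>2 + (1 - w) q\<^sup>2 = (p + q)/3 - p q\<close>.
\<close>

lemma node_product:
  assumes "a > 0"
  shows "node_p a * node_q a = (node_p a + node_q a) / 3 - 2 / 15"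
  using assms by (simp add: node_p_def node_q_def field_simps)

lemma a1_pos: "a1 > 1 / 15"
proof -
  have "sqrt 205 \<ge> 0" by simp
  then show ?thesis by (simp add: a1_def field_simps add_pos_nonneg)
qed

text \<open>
  For positive \<open>a\<close> the claim amounts to \<open>315 a\<^sup>2 - 240 a - 7 \<ge> 0\<close>, and \<open>a1\<close> is the positive root of
  this quadratic.
\<close>

lemma node_sum_ge:
  assumes "a \<ge> a1"
  shows "node_p a + node_q a \<ge> 10 / 7"
proof -
  have a: "a > 0" using a1_pos assms by linarith
  have s: "sqrt 205 * sqrt 205 = 205" by simp
  have "105 * a - 40 \<ge> 3 * sqrt 205"
    using assms unfolding a1_def by (simp add: field_simps)
  \<comment> \<open>Completing the square: \<open>(105 a - 40)\<^sup>2 - 9 * 205 = 35 (315 a\<^sup>2 - 240 a - 7)\<close>.\<close>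
  then have "(105 * a - 40)\<^sup>2 \<ge> (3 * sqrt 205)\<^sup>2"
    by (intro power_mono) auto
  then have "315 * a\<^sup>2 - 240 * a - 7 \<ge> 0"
    by (simp add: power2_eq_square s algebra_simps)
  then show ?thesis
    using a by (simp add: node_p_def node_q_def field_simps power2_eq_square)
qed

section \<open>The increment of the average\<close>

text \<open>
  Over the common denominator the numerator has degree at most four in \<open>z\<close>.  Its coefficients of \<open>z\<^sup>4\<close>, \<open>z\<^sup>3\<close>
  and \<open>z\<^sup>2\<close> vanish because of the total weight, the mean and the product of the nodes, respectively.
\<close>

lemma increment_rational_identity:
  fixes w p q z :: real
  assumes mean: "w * p + (1 - w) * q = 1 / 3"
    and prod: "p * q = (p + q) / 3 - 2 / 15"
    and "z \<noteq> 0" "(z + p)\<^sup>2 - z \<noteq> 0" "(z + q)\<^sup>2 - z \<noteq> 0"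
  shows "1 / z - w * ((z - p) / ((z + p)\<^sup>2 - z)) - (1 - w) * ((z - q) / ((z + q)\<^sup>2 - z))
       = ((p * q)\<^sup>2 + (7 * (p + q) - 10) / 45 * z)
         / (z * ((z + p)\<^sup>2 - z) * ((z + q)\<^sup>2 - z))"
proof -
  define P where "P = (z + p)\<^sup>2 - z"
  define Q where "Q = (z + q)\<^sup>2 - z"
  define R where "R = - 3 * z\<^sup>2 + (1 - (p + q)) * z + p * q"
  have nz: "P \<noteq> 0" "Q \<noteq> 0" using assms by (simp_all add: P_def Q_def)
  have pr: "15 * (p * q) = 5 * (p + q) - 2" using prod by simp
  \<comment> \<open>The weight enters only through \<open>w (p - q)\<close>, which the mean determines.  After this
      elimination a polynomial identity in \<open>p\<close>, \<open>q\<close> and \<open>z\<close> remains, valid modulo the relation for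
      \<open>p q\<close>.\<close>
  have "45 * (P * Q - z * (w * (z - p) * Q + (1 - w) * (z - q) * P))
      = 45 * (p * q)\<^sup>2 + (7 * (p + q) - 10) * z"
  proof -
    have "(z - p) * Q - (z - q) * P = (p - q) * R"
      unfolding P_def Q_def R_def by algebra
    then have "w * (z - p) * Q + (1 - w) * (z - q) * P = (z - q) * P + w * (p - q) * R"
      by algebra
    also have "w * (p - q) = 1 / 3 - q"
      using mean by (simp add: algebra_simps)
    finally have elim_w: "w * (z - p) * Q + (1 - w) * (z - q) * P
        = (z - q) * P + (1 / 3 - q) * R" .
    have "45 * (P * Q - z * (w * (z - p) * Q + (1 - w) * (z - q) * P))
        = 45 * (P * Q - z * (z - q) * P) - 15 * z * (1 - 3 * q) * R"
      unfolding elim_w by (simp add: algebra_simps)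
    also have "\<dots> = 45 * (p * q)\<^sup>2 + (7 * (p + q) - 10) * z"
      using pr unfolding P_def Q_def R_def by algebra
    finally show ?thesis .
  qed
  then have num: "P * Q - z * (w * (z - p) * Q + (1 - w) * (z - q) * P)
      = (p * q)\<^sup>2 + (7 * (p + q) - 10) / 45 * z"
    by simp
  have "1 / z - w * ((z - p) / P) - (1 - w) * ((z - q) / Q)
      = (P * Q - z * (w * (z - p) * Q + (1 - w) * (z - q) * P)) / (z * P * Q)"
    using nz \<open>z \<noteq> 0\<close> by (simp add: field_simps)
  then show ?thesis unfolding num unfolding P_def Q_def .
qed

text \<open>
  The derivative depends on \<open>y\<^sup>2\<close> only: with \<open>(y - 1)\<^sup>2 + (y - 1) + p = y\<^sup>2 - y + p\<close>, the two arguments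
  of the logarithm are exchanged by \<open>y \<mapsto> - y\<close>, so the difference of logarithms is odd.
\<close>

lemma log_ratio_deriv:
  fixes y p :: real
  assumes "y \<ge> 1" "p > 0"
  shows "((\<lambda>y. ln (y\<^sup>2 + y + p) - ln ((y - 1)\<^sup>2 + (y - 1) + p)) has_real_derivative
           - 2 * ((y\<^sup>2 - p) / ((y\<^sup>2 + p)\<^sup>2 - y\<^sup>2))) (at y)"
proof -
  have up: "y\<^sup>2 + y + p > 0" using assms by (simp add: add_nonneg_pos)
  have down: "(y - 1)\<^sup>2 + (y - 1) + p > 0" using assms by (simp add: add_nonneg_pos)
  have fac: "(y\<^sup>2 + p)\<^sup>2 - y\<^sup>2 = (y\<^sup>2 + y + p) * ((y - 1)\<^sup>2 + (y - 1) + p)"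
    by algebra
  have num: "(2 * y + 1) * ((y - 1)\<^sup>2 + (y - 1) + p) - (2 * (y - 1) + 1) * (y\<^sup>2 + y + p)
      = - 2 * (y\<^sup>2 - p)"
    by algebra
  have "(2 * y + 1) / (y\<^sup>2 + y + p) - (2 * (y - 1) + 1) / ((y - 1)\<^sup>2 + (y - 1) + p)
      = - 2 * ((y\<^sup>2 - p) / ((y\<^sup>2 + p)\<^sup>2 - y\<^sup>2))"
    unfolding fac diff_frac_eq[OF up[THEN less_imp_neq, symmetric] down[THEN less_imp_neq, symmetric]]
      num by simp
  moreover have "((\<lambda>y. ln (y\<^sup>2 + y + p) - ln ((y - 1)\<^sup>2 + (y - 1) + p)) has_real_derivative
      (2 * y + 1) / (y\<^sup>2 + y + p) - (2 * (y - 1) + 1) / ((y - 1)\<^sup>2 + (y - 1) + p)) (at y)"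
    using up down by (auto intro!: derivative_eq_intros)
  ultimately show ?thesis by simp
qed

lemma L_approx_increment_less:
  assumes "a \<ge> a1" "y \<ge> 1"
  shows "L_approx y a - L_approx (y - 1) a < 1 / y"
proof -
  define p where "p = node_p a"
  define q where "q = node_q a"
  define w where "w = weight a"
  define G where "G = (\<lambda>y. 1 / y - (w * (ln (y\<^sup>2 + y + p) - ln ((y - 1)\<^sup>2 + (y - 1) + p))
      + (1 - w) * (ln (y\<^sup>2 + y + q) - ln ((y - 1)\<^sup>2 + (y - 1) + q))) / 2)"
  have a: "a > 1 / 15" "a > 0" using a1_pos assms by linarith+
  have pq: "p > 0" "q > 0"
    using a by (simp_all add: p_def q_def node_p_pos node_q_pos)
  have deriv: "\<exists>D. (G has_real_derivative D) (at t) \<and> D < 0" if "y \<le> t" for t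
  proof -
    have t: "t \<ge> 1" using that assms by simp
    have nz: "(t\<^sup>2 + r)\<^sup>2 - t\<^sup>2 > 0" if "r > 0" for r
    proof -
      have "(t\<^sup>2 + r)\<^sup>2 - t\<^sup>2 = (t\<^sup>2 + t + r) * ((t - 1)\<^sup>2 + (t - 1) + r)" by algebra
      then show ?thesis using t that by (simp add: add_nonneg_pos)
    qed
    let ?D = "((p * q)\<^sup>2 + (7 * (p + q) - 10) / 45 * t\<^sup>2)
         / (t\<^sup>2 * ((t\<^sup>2 + p)\<^sup>2 - t\<^sup>2) * ((t\<^sup>2 + q)\<^sup>2 - t\<^sup>2))"
    have id: "?D = 1 / t\<^sup>2 - w * ((t\<^sup>2 - p) / ((t\<^sup>2 + p)\<^sup>2 - t\<^sup>2))
        - (1 - w) * ((t\<^sup>2 - q) / ((t\<^sup>2 + q)\<^sup>2 - t\<^sup>2))"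
      using node_mean[OF a(2)] node_product[OF a(2)] nz[OF pq(1)] nz[OF pq(2)] t
      by (intro increment_rational_identity[symmetric]) (auto simp: p_def q_def w_def)
    have inv: "((\<lambda>y. 1 / y) has_real_derivative - (1 / t\<^sup>2)) (at t)"
      using t by (auto intro!: derivative_eq_intros simp: power2_eq_square)
    have "(G has_real_derivative
        - (1 / t\<^sup>2) - (w * (- 2 * ((t\<^sup>2 - p) / ((t\<^sup>2 + p)\<^sup>2 - t\<^sup>2)))
          + (1 - w) * (- 2 * ((t\<^sup>2 - q) / ((t\<^sup>2 + q)\<^sup>2 - t\<^sup>2)))) / 2) (at t)"
      unfolding G_def
      by (intro DERIV_diff inv DERIV_cdivide DERIV_add DERIV_cmult log_ratio_deriv t pq)
    moreover have "- A - (w * (- 2 * B) + (1 - w) * (- 2 * C)) / 2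
        = - (A - w * B - (1 - w) * C)" for A B C
      by (simp add: field_simps)
    ultimately have "(G has_real_derivative - ?D) (at t)"
      unfolding id by (rule DERIV_cong)
    moreover have "?D > 0"
    proof (intro divide_pos_pos mult_pos_pos nz pq add_pos_nonneg)
      show "0 \<le> (7 * (p + q) - 10) / 45 * t\<^sup>2"
        using node_sum_ge[OF assms(1)] by (simp add: p_def q_def)
    qed (use t pq in auto)
    ultimately show ?thesis by (intro exI[of _ "- ?D"]) simp
  qed
  have "(G \<longlongrightarrow> 0) at_top"
    unfolding G_def by real_asymp
  then have "0 < G y"
    using deriv by (intro DERIV_neg_imp_decreasing_at_top[of y G]) blast
  then show ?thesis
    unfolding L_approx_weighted[OF a(2)] G_def p_def q_def w_def
    by (simp add: field_simps)
qed

section \<open>Monotone convergence to the Euler--Mascheroni constant\<close>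

lemma harm_minus_L_approx_strict_mono:
  assumes "a \<ge> a1"
  shows "strict_mono (\<lambda>n. harm n - L_approx (real n) a)"
proof (rule strict_monoI_Suc)
  fix n
  show "harm n - L_approx (real n) a < harm (Suc n) - L_approx (real (Suc n)) a"
    using L_approx_increment_less[OF assms, of "real (Suc n)"]
    by (simp add: harm_Suc inverse_eq_divide)
qed

lemma harm_minus_L_approx_tendsto:
  assumes "a > 0"
  shows "(\<lambda>n. harm n - L_approx (real n) a) \<longlonglongrightarrow> euler_mascheroni"
proof -
  have "(\<lambda>n. L_approx (real n) a - ln (real n)) \<longlonglongrightarrow> 0"
    unfolding L_approx_weighted[OF assms] by real_asymp
  from tendsto_diff[OF euler_mascheroni_LIMSEQ this] show ?thesis
    by simp
qed

section \<open>Dependence on the parameter\<close>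

text \<open>
  The error of the trapezoidal rule for the mean value of \<open>1 / s\<close> over the interval from \<open>t\<close> to
  \<open>t + d\<close>.
\<close>

definition trapezoid_excess :: "real \<Rightarrow> real \<Rightarrow> real" where
  "trapezoid_excess d t = (1 / t + 1 / (t + d)) / 2 - (ln (t + d) - ln t) / d"

lemma trapezoid_excess_deriv:
  assumes "d > 0" "t > 0"
  shows "(trapezoid_excess d has_real_derivative - ((1 / t - 1 / (t + d))\<^sup>2 / 2)) (at t)"
proof -
  have "(trapezoid_excess d has_real_derivative
      (- (1 / t\<^sup>2) - 1 / (t + d)\<^sup>2) / 2 - (1 / (t + d) - 1 / t) / d) (at t)"
    unfolding trapezoid_excess_def[abs_def] using assms
    by (auto intro!: derivative_eq_intros simp: power2_eq_square)
  moreover have "(1 / (t + d) - 1 / t) / d = - (1 / t * (1 / (t + d)))"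
    using assms by (simp add: diff_frac_eq mult.commute)
  moreover have "(- (1 / t\<^sup>2) - 1 / (t + d)\<^sup>2) / 2 - - (1 / t * (1 / (t + d)))
      = - ((1 / t - 1 / (t + d))\<^sup>2 / 2)"
  proof -
    have "(- A\<^sup>2 - B\<^sup>2) / 2 - - (A * B) = - ((A - B)\<^sup>2 / 2)" for A B :: real
      by (simp add: power2_diff field_simps)
    from this[of "1 / t" "1 / (t + d)"] show ?thesis
      by (simp only: power_one_over)
  qed
  ultimately show ?thesis by simp
qed

lemma trapezoid_excess_deriv_neg:
  assumes "d > 0" "t > 0"
  shows "\<exists>D. (trapezoid_excess d has_real_derivative D) (at t) \<and> D < 0"
proof -
  have "1 / (t + d) < 1 / t" using assms by (intro divide_strict_left_mono) auto
  then have "(1 / t - 1 / (t + d))\<^sup>2 > 0"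
    by (simp only: zero_less_power2 right_minus_eq)
  then have "- ((1 / t - 1 / (t + d))\<^sup>2 / 2) < 0" by simp
  then show ?thesis using trapezoid_excess_deriv[OF assms] by blast
qed

lemma trapezoid_excess_strict_antimono:
  assumes "d > 0" "0 < s" "s < t"
  shows "trapezoid_excess d t < trapezoid_excess d s"
proof (rule DERIV_neg_imp_decreasing[OF assms(3)])
  fix x assume "s \<le> x"
  then show "\<exists>D. (trapezoid_excess d has_real_derivative D) (at x) \<and> D < 0"
    using assms by (intro trapezoid_excess_deriv_neg) auto
qed

text \<open>
  Positivity expresses the convexity of \<open>1 / s\<close>; here it comes from strict decrease to the limit zero.
\<close>

lemma trapezoid_excess_pos:
  assumes "d > 0" "t > 0"
  shows "trapezoid_excess d t > 0"
proof (rule DERIV_neg_imp_decreasing_at_top[of t])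
  show "(trapezoid_excess d \<longlongrightarrow> 0) at_top"
    unfolding trapezoid_excess_def[abs_def] using \<open>d > 0\<close> by real_asymp
qed (use assms in \<open>auto intro!: trapezoid_excess_deriv_neg\<close>)

text \<open>
  Two relations turn the derivative into a trapezoid excess: \<open>w' = - 90 a w\<^sup>2 = - 2 w / (p - q)\<close>, so
  that the change of the weights produces the difference quotient of \<open>ln\<close>, and
  \<open>w p' = (1 - w) q' = w\<close>, so that both endpoints receive the same weight.
\<close>

lemma L_approx_deriv_parameter:
  assumes "a > 1 / 15" "x \<ge> 0"
  shows "(L_approx x has_real_derivative
    weight a * trapezoid_excess (node_p a - node_q a) (x\<^sup>2 + x + node_q a)) (at a)"
proof -
  define A where "A = x\<^sup>2 + x + node_p a"
  define B where "B = x\<^sup>2 + x + node_q a"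
  define w where "w = weight a"
  have a: "a > 0" using assms by simp
  have pos: "45 * a\<^sup>2 + 1 > 0" by (simp add: add_nonneg_pos)
  have AB: "A > 0" "B > 0"
    using assms node_p_pos[OF a] node_q_pos[OF assms(1)]
    by (auto simp: A_def B_def intro!: add_nonneg_pos)
  have "((\<lambda>a. 45 * a\<^sup>2 + 1) has_real_derivative 90 * a) (at a)"
    by (auto intro!: derivative_eq_intros)
  from DERIV_inverse_fun[OF this] pos
  have w': "(weight has_real_derivative - (90 * a * w\<^sup>2)) (at a)"
    by (simp add: weight_def[abs_def] w_def inverse_eq_divide power2_eq_square)
  have p': "((\<lambda>a. ln (x\<^sup>2 + x + node_p a)) has_real_derivative 1 / A) (at a)"
    using AB unfolding A_def node_p_def by (auto intro!: derivative_eq_intros)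
  have q': "((\<lambda>a. ln (x\<^sup>2 + x + node_q a)) has_real_derivative 1 / (45 * a\<^sup>2) / B) (at a)"
    using AB a unfolding B_def node_q_def
    by (auto intro!: derivative_eq_intros simp: power2_eq_square)
  have "((\<lambda>a. (weight a * ln (x\<^sup>2 + x + node_p a) + (1 - weight a) * ln (x\<^sup>2 + x + node_q a)) / 2)
      has_real_derivative
        ((- (90 * a * w\<^sup>2)) * ln A + 1 / A * w
          + ((0 - - (90 * a * w\<^sup>2)) * ln B + 1 / (45 * a\<^sup>2) / B * (1 - w))) / 2) (at a)"
    unfolding A_def B_def w_def
    by (intro DERIV_cdivide DERIV_add DERIV_mult DERIV_diff DERIV_const
        w'[unfolded w_def] p'[unfolded A_def] q'[unfolded B_def])
  moreover have "((- (90 * a * w\<^sup>2)) * ln A + 1 / A * w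
          + ((0 - - (90 * a * w\<^sup>2)) * ln B + 1 / (45 * a\<^sup>2) / B * (1 - w))) / 2
      = w * trapezoid_excess (node_p a - node_q a) B"
  proof -
    have sum: "B + (node_p a - node_q a) = A" by (simp add: A_def B_def)
    have "node_p a - node_q a = (45 * a\<^sup>2 + 1) / (45 * a)"
      using a by (simp add: node_p_def node_q_def field_simps power2_eq_square)
    then have d: "1 / (node_p a - node_q a) = 45 * a * w"
      by (simp add: w_def weight_def)
    have v: "1 / (45 * a\<^sup>2) * (1 - w) = w"
      using a pos by (simp add: w_def weight_def field_simps)
    have below: "1 / (45 * a\<^sup>2) / B * (1 - w) = w / B"
      using v by (metis times_divide_eq_left)
    have excess: "trapezoid_excess (node_p a - node_q a) B
        = (1 / B + 1 / A) / 2 - (ln A - ln B) * (45 * a * w)"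
      unfolding trapezoid_excess_def sum d[symmetric] by simp
    show ?thesis
      unfolding below excess
      by (simp add: power2_eq_square algebra_simps add_divide_distrib diff_divide_distrib)
  qed
  ultimately have "((\<lambda>a. (weight a * ln (x\<^sup>2 + x + node_p a)
      + (1 - weight a) * ln (x\<^sup>2 + x + node_q a)) / 2)
      has_real_derivative w * trapezoid_excess (node_p a - node_q a) B) (at a)"
    by simp
  then have "(L_approx x has_real_derivative w * trapezoid_excess (node_p a - node_q a) B) (at a)"
    by (rule has_field_derivative_transform_within_open[of _ _ _ "{0<..}"])
      (use a L_approx_weighted in auto)
  then show ?thesis by (simp add: w_def B_def)
qed

lemma node_gap_pos: "a > 0 \<Longrightarrow> node_p a - node_q a > 0"
  by (simp add: node_p_def node_q_def add_pos_pos)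

lemma L_approx_strict_mono_parameter:
  assumes "x \<ge> 0"
  shows "strict_mono_on {1 / 15<..} (L_approx x)"
proof (rule strict_mono_onI)
  fix a b :: real
  assume ab: "a \<in> {1 / 15<..}" "b \<in> {1 / 15<..}" "a < b"
  show "L_approx x a < L_approx x b"
  proof (rule DERIV_pos_imp_increasing[OF ab(3)])
    fix t assume "a \<le> t" "t \<le> b"
    then have t: "t > 1 / 15" "t > 0" using ab by auto
    have "weight t * trapezoid_excess (node_p t - node_q t) (x\<^sup>2 + x + node_q t) > 0"
      using t assms
      by (intro mult_pos_pos weight_pos trapezoid_excess_pos node_gap_pos)
        (auto intro!: add_nonneg_pos node_q_pos)
    then show "\<exists>D. (L_approx x has_real_derivative D) (at t) \<and> 0 < D"
      using L_approx_deriv_parameter[OF t(1) assms] by blast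
  qed
qed

lemma L_approx_difference_strict_antimono_parameter:
  assumes "0 \<le> x" "x < y"
  shows "strict_antimono_on {1 / 15<..} (\<lambda>a. L_approx y a - L_approx x a)"
proof (rule monotone_onI)
  fix a b :: real
  assume ab: "a \<in> {1 / 15<..}" "b \<in> {1 / 15<..}" "a < b"
  show "L_approx y b - L_approx x b < L_approx y a - L_approx x a"
  proof (rule DERIV_neg_imp_decreasing[OF ab(3)])
    fix t assume "a \<le> t" "t \<le> b"
    then have t: "t > 1 / 15" "t > 0" using ab by auto
    let ?T = "\<lambda>x. trapezoid_excess (node_p t - node_q t) (x\<^sup>2 + x + node_q t)"
    have "x\<^sup>2 \<le> y\<^sup>2" using assms by (intro power_mono) auto
    then have "x\<^sup>2 + x < y\<^sup>2 + y" using assms by linarith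
    then have "?T y < ?T x"
      using assms t
      by (intro trapezoid_excess_strict_antimono node_gap_pos)
        (auto intro!: add_nonneg_pos node_q_pos)
    then have "weight t * ?T y - weight t * ?T x < 0"
      using weight_pos[of t] by simp
    moreover have "((\<lambda>a. L_approx y a - L_approx x a) has_real_derivative
        weight t * ?T y - weight t * ?T x) (at t)"
      using assms t by (intro DERIV_diff L_approx_deriv_parameter) auto
    ultimately show "\<exists>D. ((\<lambda>a. L_approx y a - L_approx x a) has_real_derivative D) (at t) \<and> D < 0"
      by blast
  qed
qed

section \<open>Sharp bounds for the harmonic numbers\<close>

theorem corollary6:
  shows "(\<forall>a\<ge>a1.
            (\<forall>n::nat. n \<ge> 1 \<longrightarrow>
               L_approx (real n) a + c1 a \<le> harm n \<and>
               (L_approx (real n) a + c1 a = harm n \<longleftrightarrow> n = 1) \<and>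
               harm n < L_approx (real n) a + euler_mascheroni) \<and>
            (\<forall>c::real. (\<forall>n::nat. n \<ge> 1 \<longrightarrow> L_approx (real n) a + c \<le> harm n) \<longrightarrow> c \<le> c1 a) \<and>
            (\<forall>c::real. (\<forall>n::nat. n \<ge> 1 \<longrightarrow> harm n \<le> L_approx (real n) a + c) \<longrightarrow> euler_mascheroni \<le> c))
       \<and> (\<forall>n::nat. n \<ge> 1 \<longrightarrow>
            antimono_on {a1<..} (\<lambda>a. L_approx (real n) a + c1 a) \<and>
            (n \<ge> 2 \<longrightarrow> strict_antimono_on {a1<..} (\<lambda>a. L_approx (real n) a + c1 a)) \<and>
            strict_mono_on {a1<..} (\<lambda>a. L_approx (real n) a + euler_mascheroni))"
proof (intro conjI allI impI)
  fix a :: real assume a: "a \<ge> a1"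
  define D where "D = (\<lambda>n. harm n - L_approx (real n) a)"
  have mono: "strict_mono D"
    unfolding D_def by (rule harm_minus_L_approx_strict_mono[OF a])
  have lim: "D \<longlonglongrightarrow> euler_mascheroni"
    unfolding D_def using a a1_pos by (intro harm_minus_L_approx_tendsto) simp
  have D1: "D 1 = c1 a"
    by (simp add: D_def c1_def harm_def)
  {
    fix n :: nat assume n: "n \<ge> 1"
    have ge: "c1 a \<le> D n"
      using strict_mono_less_eq[OF mono, of 1 n] n D1 by simp
    then show "L_approx (real n) a + c1 a \<le> harm n"
      by (simp add: D_def)
    have "D n = D 1 \<longleftrightarrow> n = 1"
      by (rule strict_mono_eq[OF mono])
    then show "L_approx (real n) a + c1 a = harm n \<longleftrightarrow> n = 1"
      unfolding D1 by (auto simp: D_def)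
    have "D n < D (Suc n)"
      by (rule strict_monoD[OF mono]) simp
    also have "D (Suc n) \<le> euler_mascheroni"
      by (rule incseq_le[OF strict_mono_mono[OF mono] lim])
    finally show "harm n < L_approx (real n) a + euler_mascheroni"
      by (simp add: D_def)
  }
  {
    fix c :: real assume "\<forall>n\<ge>1. L_approx (real n) a + c \<le> harm n"
    then have "c \<le> D 1" by (force simp: D_def)
    then show "c \<le> c1 a" unfolding D1 .
  }
  {
    fix c :: real assume "\<forall>n\<ge>1. harm n \<le> L_approx (real n) a + c"
    then have "\<forall>n\<ge>1. D n \<le> c" by (simp add: D_def algebra_simps)
    then show "euler_mascheroni \<le> c"
      by (intro LIMSEQ_le_const2[OF lim]) blast
  }
next
  fix n :: nat assume n: "n \<ge> 1"
  have sub: "{a1<..} \<subseteq> {1 / 15<..}" using a1_pos by auto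
  have strict: "strict_antimono_on {a1<..} (\<lambda>a. L_approx (real n) a + c1 a)" if "n \<ge> 2"
    using monotone_on_subset[OF L_approx_difference_strict_antimono_parameter[of 1 "real n"] sub] that
    by (simp add: c1_def monotone_on_def)
  show "strict_antimono_on {a1<..} (\<lambda>a. L_approx (real n) a + c1 a)" if "n \<ge> 2"
    using that by (rule strict)
  show "antimono_on {a1<..} (\<lambda>a. L_approx (real n) a + c1 a)"
  proof (cases "n = 1")
    case True
    then show ?thesis by (simp add: c1_def monotone_on_def)
  next
    case False
    then show ?thesis
      using strict n by (force simp: monotone_on_def le_less)
  qed
  show "strict_mono_on {a1<..} (\<lambda>a. L_approx (real n) a + euler_mascheroni)"
    using monotone_on_subset[OF L_approx_strict_mono_parameter[of "real n"] sub]
    by (simp add: monotone_on_def)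
qed

end
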